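(* A matrix $A\in\mathcal{S}_+^n$ spans an extreme ray of $(FW_k^n)^*$ if and only if $A$ has rank $1$.
   Context: Here $n$ and $k$ are positive integers. $\mathcal{S}^n$ denotes the space of real symmetric $n\times n$ matrices with inner product $\langle A,B\rangle=\operatorname{trace}(AB^T)=\sum_{i,j}A_{ij}B_{ij}$, and $\mathcal{S}^n_+$ the cone of positive semidefinite matrices in $\mathcal{S}^n$. The factor width of a real symmetric positive semidefinite $n\times n$ matrix $A$ is the smallest integer $k$ such that $A=VV^T$ for some real (rectangular) matrix $V$ each of whose columns has at most $k$ nonzero entries. $FW_k^n$ is the set of positive semidefinite $n\times n$ matrices of factor width at most $k$; it is a closed convex cone. Its dual cone is $(FW_k^n)^*=\{Y\in\mathcal{S}^n:\langle Y,X\rangle\ge 0\ \text{for all } X\in FW_k^n\}$. A nonzero element $A$ of a convex cone $C$ spans an extreme ray of $C$ if whenever $A=X+Y$ with $X,Y\in C$, both $X$ and $Y$ are nonnegative multiples of $A$.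
   Formalization: The case k = 1 with n ≥ 2 is excluded: there the dual cone is all symmetric matrices with nonnegative diagonal, which contains lines, so rank-one matrices such as e1 e1^T do not span extreme rays and the claim fails. *)

theory Defs
  imports "Jordan_Normal_Form.DL_Rank"
begin

definition sym_mats :: "nat \<Rightarrow> real mat set" where
  "sym_mats n = {A \<in> carrier_mat n n. transpose_mat A = A}"

definition psd_mats :: "nat \<Rightarrow> real mat set" where
  "psd_mats n = {A \<in> sym_mats n. \<forall>x \<in> carrier_vec n. 0 \<le> x \<bullet> (A *\<^sub>v x)}"

definition mat_trace :: "real mat \<Rightarrow> real" where
  "mat_trace A = (\<Sum>i<dim_row A. A $$ (i, i))"

definition mat_inner :: "real mat \<Rightarrow> real mat \<Rightarrow> real" where
  "mat_inner A B = mat_trace (A * transpose_mat B)"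

(* The number of columns of V is unrestricted; A = V * V^T forces V to have as many rows as A.
   The value is meaningful only for positive semidefinite A: otherwise no such V exists. *)
definition factor_width :: "real mat \<Rightarrow> nat" where
  "factor_width A = (LEAST k. \<exists>V. A = V * transpose_mat V \<and>
     (\<forall>j < dim_col V. card {i. i < dim_row V \<and> V $$ (i, j) \<noteq> 0} \<le> k))"

definition FW :: "nat \<Rightarrow> nat \<Rightarrow> real mat set" where
  "FW k n = {A \<in> psd_mats n. factor_width A \<le> k}"

definition dual_cone :: "nat \<Rightarrow> real mat set \<Rightarrow> real mat set" where
  "dual_cone n C = {Y \<in> sym_mats n. \<forall>X \<in> C. 0 \<le> mat_inner Y X}"

definition spans_extreme_ray :: "real mat set \<Rightarrow> real mat \<Rightarrow> bool" where
  "spans_extreme_ray C A \<longleftrightarrow>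
     A \<in> C \<and> A \<noteq> 0\<^sub>m (dim_row A) (dim_col A) \<and>
     (\<forall>X \<in> C. \<forall>Y \<in> C. A = X + Y \<longrightarrow>
        (\<exists>a \<ge> 0. X = a \<cdot>\<^sub>m A) \<and> (\<exists>b \<ge> 0. Y = b \<cdot>\<^sub>m A))"

end

theory Submission
  imports Defs
begin

text \<open>
  If \<open>A\<close> is positive semidefinite with \<open>A p p > 0\<close> and \<open>u\<close> is its \<open>p\<close>-th column, then
  \<open>A - u u\<^sup>T / A p p\<close> is again positive semidefinite (completing the square). Both summands lie in the
  dual cone, so an extreme \<open>A\<close> is a multiple of \<open>u u\<^sup>T\<close>. Iterating the same splitting writes
  every positive semidefinite matrix as a sum of such rank one terms, which shows that the positive
  semidefinite cone is contained in the dual cone.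

  Conversely, every element of the dual cone has a nonnegative quadratic form on vectors with at
  most \<open>k\<close> nonzero entries. If \<open>a a\<^sup>T = X + Y\<close>, both forms vanish at \<open>a\<^sub>j e\<^sub>i - a\<^sub>i e\<^sub>j\<close>, and
  since they are nonnegative on the plane spanned by \<open>e\<^sub>i\<close> and \<open>e\<^sub>j\<close> (this is where \<open>2 \<le> k\<close>
  enters), this pins down their \<open>2 \<times> 2\<close> principal submatrices up to a scalar.
\<close>

section \<open>Quadratic forms and rank one squares\<close>

definition quad_form :: "nat \<Rightarrow> real mat \<Rightarrow> (nat \<Rightarrow> real) \<Rightarrow> real" where
  "quad_form n A x = (\<Sum>i<n. \<Sum>j<n. A $$ (i, j) * x i * x j)"

definition outer_square :: "nat \<Rightarrow> (nat \<Rightarrow> real) \<Rightarrow> real mat" where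
  "outer_square n x = mat n n (\<lambda>(i, j). x i * x j)"

lemma outer_square_carrier [simp]: "outer_square n x \<in> carrier_mat n n"
  by (simp add: outer_square_def)

lemma outer_square_dim [simp]:
  "dim_row (outer_square n x) = n" "dim_col (outer_square n x) = n"
  by (simp_all add: outer_square_def)

lemma outer_square_index [simp]:
  "i < n \<Longrightarrow> j < n \<Longrightarrow> outer_square n x $$ (i, j) = x i * x j"
  by (simp add: outer_square_def)

lemma sym_mats_iff:
  "A \<in> sym_mats n \<longleftrightarrow> A \<in> carrier_mat n n \<and> (\<forall>i<n. \<forall>j<n. A $$ (i, j) = A $$ (j, i))"
proof -
  have "transpose_mat A = A \<longleftrightarrow> (\<forall>i<n. \<forall>j<n. A $$ (i, j) = A $$ (j, i))"
    if "A \<in> carrier_mat n n"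
  proof
    assume "transpose_mat A = A"
    then show "\<forall>i<n. \<forall>j<n. A $$ (i, j) = A $$ (j, i)"
      using that by (metis carrier_matD index_transpose_mat(1))
  next
    assume "\<forall>i<n. \<forall>j<n. A $$ (i, j) = A $$ (j, i)"
    with that show "transpose_mat A = A"
      by (intro eq_matI) auto
  qed
  then show ?thesis
    unfolding sym_mats_def by blast
qed

lemma scalar_prod_mult_mat_vec_eq_quad_form:
  assumes "A \<in> carrier_mat n n" "v \<in> carrier_vec n"
  shows "v \<bullet> (A *\<^sub>v v) = quad_form n A (($) v)"
proof -
  have "v \<bullet> (A *\<^sub>v v) = (\<Sum>i<n. v $ i * (\<Sum>j<n. A $$ (i, j) * v $ j))"
    using assms by (auto simp: scalar_prod_def atLeast0LessThan intro!: sum.cong)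
  then show ?thesis
    by (simp add: quad_form_def sum_distrib_left mult_ac)
qed

lemma quad_form_cong: "(\<And>i. i < n \<Longrightarrow> x i = y i) \<Longrightarrow> quad_form n A x = quad_form n A y"
  by (simp add: quad_form_def)

text \<open>Only the values of \<open>x\<close> below \<open>n\<close> enter the form, so total
  functions can replace vectors of dimension \<open>n\<close>; test vectors can then be written as
  lambda terms.\<close>

lemma psd_mats_iff: "A \<in> psd_mats n \<longleftrightarrow> A \<in> sym_mats n \<and> (\<forall>x. 0 \<le> quad_form n A x)"
proof -
  have "(\<forall>v \<in> carrier_vec n. 0 \<le> v \<bullet> (A *\<^sub>v v)) \<longleftrightarrow> (\<forall>x. 0 \<le> quad_form n A x)"
    if A: "A \<in> carrier_mat n n"
  proof safe
    fix x
    assume *: "\<forall>v \<in> carrier_vec n. 0 \<le> v \<bullet> (A *\<^sub>v v)"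
    have "quad_form n A (($) (vec n x)) = quad_form n A x"
      by (rule quad_form_cong) simp
    then show "0 \<le> quad_form n A x"
      using *[rule_format, of "vec n x"] scalar_prod_mult_mat_vec_eq_quad_form[OF A, of "vec n x"]
      by simp
  next
    fix v :: "real vec"
    assume "\<forall>x. 0 \<le> quad_form n A x" "v \<in> carrier_vec n"
    then show "0 \<le> v \<bullet> (A *\<^sub>v v)"
      using scalar_prod_mult_mat_vec_eq_quad_form[OF A] by simp
  qed
  then show ?thesis
    unfolding psd_mats_def by (auto simp: sym_mats_iff)
qed

lemma mat_inner_eq_sum:
  assumes "A \<in> carrier_mat n n" "B \<in> carrier_mat n n"
  shows "mat_inner A B = (\<Sum>i<n. \<Sum>j<n. A $$ (i, j) * B $$ (i, j))"
  using assms
  by (auto simp: mat_inner_def mat_trace_def scalar_prod_def atLeast0LessThan intro!: sum.cong)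

lemma mat_inner_outer_square:
  assumes "A \<in> carrier_mat n n"
  shows "mat_inner A (outer_square n x) = quad_form n A x"
  using assms by (simp add: mat_inner_eq_sum quad_form_def mult.assoc)

lemma quad_form_outer_square: "quad_form n (outer_square n y) x = (\<Sum>i<n. y i * x i)\<^sup>2"
  by (simp add: quad_form_def power2_eq_square sum_product mult_ac)

lemma quad_form_add:
  assumes "A \<in> carrier_mat n n" "B \<in> carrier_mat n n"
  shows "quad_form n (A + B) x = quad_form n A x + quad_form n B x"
  using assms by (simp add: quad_form_def sum.distrib distrib_right)

lemma quad_form_smult:
  assumes "A \<in> carrier_mat n n"
  shows "quad_form n (c \<cdot>\<^sub>m A) x = c * quad_form n A x"
  using assms by (simp add: quad_form_def sum_distrib_left mult_ac)

text \<open>Symmetry merges the two cross terms of the expansion. Choosing \<open>t\<close> as the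
  minimizer completes the square; leaving it free gives the restriction to coordinate
  planes.\<close>

lemma quad_form_add_unit:
  assumes "A \<in> sym_mats n" "p < n"
  shows "quad_form n A (\<lambda>i. x i + (if i = p then t else 0))
    = quad_form n A x + 2 * t * (\<Sum>i<n. A $$ (i, p) * x i) + t\<^sup>2 * A $$ (p, p)"
proof -
  let ?d = "\<lambda>i. if i = p then t else (0::real)"
  have "quad_form n A (\<lambda>i. x i + ?d i)
    = quad_form n A x + (\<Sum>i<n. \<Sum>j<n. A $$ (i, j) * x i * ?d j)
      + (\<Sum>i<n. \<Sum>j<n. A $$ (i, j) * ?d i * x j) + (\<Sum>i<n. \<Sum>j<n. A $$ (i, j) * ?d i * ?d j)"
    by (simp only: quad_form_def distrib_left distrib_right sum.distrib add_ac)
  also have "(\<Sum>i<n. \<Sum>j<n. A $$ (i, j) * x i * ?d j) = t * (\<Sum>i<n. A $$ (i, p) * x i)"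
    using assms by (simp add: if_distrib[of "(*) _"] sum.delta sum_distrib_left mult_ac cong: if_cong)
  also have "(\<Sum>i<n. \<Sum>j<n. A $$ (i, j) * ?d i * x j)
      = (\<Sum>i<n. if i = p then \<Sum>j<n. A $$ (i, j) * t * x j else 0)"
    by (intro sum.cong) auto
  also have "\<dots> = (\<Sum>j<n. A $$ (p, j) * t * x j)"
    using assms by (simp add: sum.delta)
  also have "\<dots> = t * (\<Sum>j<n. A $$ (j, p) * x j)"
    unfolding sum_distrib_left using assms by (intro sum.cong) (auto simp: sym_mats_iff)
  also have "(\<Sum>i<n. \<Sum>j<n. A $$ (i, j) * ?d i * ?d j)
      = (\<Sum>i<n. if i = p then \<Sum>j<n. if j = p then A $$ (i, j) * t * t else 0 else 0)"
    by (intro sum.cong refl) (simp add: if_distrib[of "(*) _"] cong: if_cong)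
  also have "\<dots> = t\<^sup>2 * A $$ (p, p)"
    using assms by (simp add: sum.delta power2_eq_square)
  finally show ?thesis
    by (simp add: algebra_simps)
qed

lemma quad_form_two_units:
  assumes "A \<in> sym_mats n" "p < n" "q < n"
  shows "quad_form n A (\<lambda>i. (if i = q then s else 0) + (if i = p then t else 0))
    = s\<^sup>2 * A $$ (q, q) + 2 * s * t * A $$ (q, p) + t\<^sup>2 * A $$ (p, p)"
proof -
  have "quad_form n A (\<lambda>i. if i = q then s else 0) = s\<^sup>2 * A $$ (q, q)"
    using quad_form_add_unit[OF assms(1,3), of "\<lambda>_. 0" s] by (simp add: quad_form_def)
  moreover have "(\<Sum>i<n. A $$ (i, p) * (if i = q then s else 0)) = s * A $$ (q, p)"
    using assms by (simp add: if_distrib[of "(*) _"] sum.delta cong: if_cong)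
  ultimately show ?thesis
    using quad_form_add_unit[OF assms(1,2), of "\<lambda>i. if i = q then s else 0" t] by simp
qed

text \<open>For small \<open>t\<close> of sign opposite to \<open>m\<close>, the linear term would
  outweigh the quadratic one.\<close>

lemma linear_coeff_eq_zero_if_quadratic_nonneg:
  fixes m x :: real
  assumes "\<And>t. 0 \<le> 2 * t * m + t\<^sup>2 * x"
  shows "m = 0"
proof (rule ccontr)
  assume "m \<noteq> 0"
  \<comment> \<open>At \<open>t = - m / d\<close> the linear term is \<open>- 2 * m^2 / d\<close>
    and the quadratic one \<open>m^2 * x / d^2\<close>, so \<open>x < 2 * d\<close> makes the sum
    negative.\<close>
  define d where "d = \<bar>x\<bar> + 1"
  have d: "d > 0" "x < 2 * d" by (auto simp: d_def)
  have "2 * (- m / d) * m + (- m / d)\<^sup>2 * x = m\<^sup>2 / d\<^sup>2 * (x - 2 * d)"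
    using d by (simp add: field_simps power2_eq_square)
  also have "\<dots> < 0"
    using d \<open>m \<noteq> 0\<close> by (intro mult_pos_neg) auto
  finally show False
    using assms[of "- m / d"] by simp
qed

section \<open>Positive semidefinite matrices and their self-duality\<close>

lemma psd_mats_plane_nonneg:
  assumes "A \<in> psd_mats n" "p < n" "q < n"
  shows "0 \<le> s\<^sup>2 * A $$ (q, q) + 2 * s * t * A $$ (q, p) + t\<^sup>2 * A $$ (p, p)"
proof -
  have "A \<in> sym_mats n" "0 \<le> quad_form n A x" for x
    using assms(1) by (simp_all add: psd_mats_iff)
  then show ?thesis
    using assms(2,3) by (simp only: quad_form_two_units[symmetric])
qed

lemma psd_mats_diag_nonneg:
  assumes "A \<in> psd_mats n" "p < n"
  shows "0 \<le> A $$ (p, p)"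
  using psd_mats_plane_nonneg[OF assms assms(2), of 0 1] by simp

lemma psd_mats_zero_diag:
  assumes "A \<in> psd_mats n" "p < n" "q < n" "A $$ (q, q) = 0"
  shows "A $$ (q, p) = 0"
proof (rule linear_coeff_eq_zero_if_quadratic_nonneg)
  show "0 \<le> 2 * t * A $$ (q, p) + t\<^sup>2 * A $$ (p, p)" for t
    using psd_mats_plane_nonneg[OF assms(1-3), of 1 t] assms(4) by simp
qed

lemma psd_mats_eq_zero_if_diag_zero:
  assumes "A \<in> psd_mats n" "\<And>p. p < n \<Longrightarrow> A $$ (p, p) = 0"
  shows "A = 0\<^sub>m n n"
  using assms psd_mats_zero_diag[OF assms(1)]
  by (intro eq_matI) (auto simp: psd_mats_iff sym_mats_iff)

lemma outer_square_psd: "outer_square n x \<in> psd_mats n"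
  by (auto simp: psd_mats_iff sym_mats_iff quad_form_outer_square)

lemma smult_psd: "A \<in> psd_mats n \<Longrightarrow> 0 \<le> c \<Longrightarrow> c \<cdot>\<^sub>m A \<in> psd_mats n"
  by (auto simp: psd_mats_iff sym_mats_iff quad_form_smult)

text \<open>One step of symmetric Gaussian elimination with pivot \<open>p\<close>; \<open>B\<close>
  is the Schur complement of the pivot, padded with a zero row and column.\<close>

lemma psd_mats_split:
  assumes "A \<in> psd_mats n" "p < n" "0 < A $$ (p, p)"
  obtains B where "B \<in> psd_mats n"
    "A = (1 / A $$ (p, p)) \<cdot>\<^sub>m outer_square n (\<lambda>i. A $$ (i, p)) + B"
proof
  let ?c = "A $$ (p, p)"
  let ?u = "\<lambda>i. A $$ (i, p)"
  let ?B = "A + (- 1 / ?c) \<cdot>\<^sub>m outer_square n ?u"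
  have sym: "A \<in> sym_mats n" and A: "A \<in> carrier_mat n n"
    using assms by (auto simp: psd_mats_iff sym_mats_iff)
  have "0 \<le> quad_form n ?B x" for x
  proof -
    define w where "w = (\<Sum>i<n. ?u i * x i)"
    have "quad_form n ?B x = quad_form n A x - w\<^sup>2 / ?c"
      using A by (simp add: quad_form_add quad_form_smult quad_form_outer_square w_def)
    \<comment> \<open>The shift \<open>- w / ?c\<close> minimizes the form of \<open>A\<close> along
      the line through \<open>x\<close> in direction \<open>p\<close>, and the minimum is
      \<open>quad_form n A x - w^2 / ?c\<close>.\<close>
    also have "\<dots> = quad_form n A (\<lambda>i. x i + (if i = p then - w / ?c else 0))"
      unfolding quad_form_add_unit[OF sym \<open>p < n\<close>] w_def[symmetric]
      using assms(3) by (simp add: field_simps power2_eq_square)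
    finally show ?thesis
      using assms(1) by (simp add: psd_mats_iff)
  qed
  then show "?B \<in> psd_mats n"
    using sym by (auto simp: psd_mats_iff sym_mats_iff)
  show "A = (1 / ?c) \<cdot>\<^sub>m outer_square n ?u + ?B"
    using A by (intro eq_matI) auto
qed

text \<open>Induction on the number of nonzero diagonal entries of \<open>X\<close>: splitting off a
  rank one term lowers it, and that term contributes a nonnegative multiple of the form of
  \<open>A\<close> at \<open>?u\<close>.\<close>

lemma mat_inner_psd_nonneg:
  assumes "A \<in> psd_mats n" "X \<in> psd_mats n"
  shows "0 \<le> mat_inner A X"
  using assms(2)
proof (induction "card {i. i < n \<and> X $$ (i, i) \<noteq> 0}" arbitrary: X rule: less_induct)
  case less
  have A: "A \<in> carrier_mat n n" and X: "X \<in> carrier_mat n n"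
    using assms less by (auto simp: psd_mats_iff sym_mats_iff)
  show ?case
  proof (cases "\<forall>p<n. X $$ (p, p) = 0")
    case True
    then show ?thesis
      using psd_mats_eq_zero_if_diag_zero[OF less.prems] A by (simp add: mat_inner_eq_sum)
  next
    case False
    then obtain p where p: "p < n" "X $$ (p, p) \<noteq> 0"
      by blast
    let ?u = "\<lambda>i. X $$ (i, p)"
    have pos: "0 < X $$ (p, p)"
      using psd_mats_diag_nonneg[OF less.prems p(1)] p(2) by simp
    obtain B where B: "B \<in> psd_mats n"
      and split: "X = (1 / X $$ (p, p)) \<cdot>\<^sub>m outer_square n ?u + B"
      using psd_mats_split[OF less.prems p(1) pos] .
    have BC: "B \<in> carrier_mat n n"
      using B by (simp add: psd_mats_iff sym_mats_iff)
    have entry: "X $$ (i, j) = ?u i * ?u j / X $$ (p, p) + B $$ (i, j)" if "i < n" "j < n" for i j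
      using that BC by (subst split) simp
    have "B $$ (p, p) = 0"
      using entry[OF p(1) p(1)] pos by simp
    \<comment> \<open>A zero diagonal entry of \<open>X\<close> forces \<open>?u i = 0\<close>, so
      the splitting leaves it zero.\<close>
    moreover have "X $$ (i, i) \<noteq> 0" if "i < n" "B $$ (i, i) \<noteq> 0" for i
      using psd_mats_zero_diag[OF less.prems p(1) that(1)] entry[OF that(1) that(1)] that by auto
    ultimately have "{i. i < n \<and> B $$ (i, i) \<noteq> 0} \<subset> {i. i < n \<and> X $$ (i, i) \<noteq> 0}"
      using p by blast
    then have "0 \<le> mat_inner A B"
      using less.hyps[OF _ B] by (simp add: psubset_card_mono)
    moreover have "mat_inner A X = quad_form n A ?u / X $$ (p, p) + mat_inner A B"
      using A X BC
      by (simp add: mat_inner_eq_sum quad_form_def entry distrib_left sum.distrib sum_divide_distrib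
          mult_ac)
    ultimately show ?thesis
      using assms(1) pos by (simp add: psd_mats_iff)
  qed
qed

section \<open>The dual cone and its sparse test vectors\<close>

lemma psd_subset_dual_FW: "psd_mats n \<subseteq> dual_cone n (FW k n)"
  using mat_inner_psd_nonneg by (auto simp: dual_cone_def FW_def psd_mats_iff)

text \<open>The vector itself, as a single column, is a factor. Pairing with these matrices
  evaluates the form of a dual element at sparse vectors.\<close>

lemma outer_square_in_FW:
  assumes "card {i. i < n \<and> x i \<noteq> 0} \<le> k"
  shows "outer_square n x \<in> FW k n"
proof -
  let ?V = "mat n 1 (\<lambda>(i, _). x i)"
  have "outer_square n x = ?V * transpose_mat ?V"
    by (intro eq_matI) (auto simp: scalar_prod_def)
  moreover have "{i. i < dim_row ?V \<and> ?V $$ (i, j) \<noteq> 0} = {i. i < n \<and> x i \<noteq> 0}"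
    if "j < dim_col ?V" for j
    using that by auto
  ultimately have "factor_width (outer_square n x) \<le> k"
    unfolding factor_width_def using assms by (intro Least_le exI[of _ ?V]) auto
  then show ?thesis
    by (simp add: FW_def outer_square_psd)
qed

lemma dual_FW_quad_form_nonneg:
  assumes "X \<in> dual_cone n (FW k n)" "card {i. i < n \<and> x i \<noteq> 0} \<le> k"
  shows "0 \<le> quad_form n X x"
  using assms outer_square_in_FW[OF assms(2)]
  by (auto simp: dual_cone_def sym_mats_iff mat_inner_outer_square[symmetric])

lemma dual_FW_diag_nonneg:
  assumes "X \<in> dual_cone n (FW k n)" "0 < k" "p < n"
  shows "0 \<le> X $$ (p, p)"
proof -
  \<comment> \<open>The vanishing first summand gives the shape of
    \<open>quad_form_two_units\<close> with \<open>q = p\<close> and \<open>s = 0\<close>. The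
    support is a single index, so \<open>0 < k\<close> suffices.\<close>
  let ?x = "\<lambda>i. (if i = p then 0 else 0) + (if i = p then 1 else (0::real))"
  have "card {i. i < n \<and> ?x i \<noteq> 0} \<le> card {p}"
    by (intro card_mono) auto
  then have "0 \<le> quad_form n X ?x"
    using assms(2) by (intro dual_FW_quad_form_nonneg[OF assms(1)]) simp
  then show ?thesis
    using quad_form_two_units[of X n p p 0 1] assms by (simp add: dual_cone_def)
qed

lemma dual_FW_plane_nonneg:
  assumes "X \<in> dual_cone n (FW k n)" "2 \<le> k" "p < n" "q < n"
  shows "0 \<le> s\<^sup>2 * X $$ (p, p) + 2 * s * t * X $$ (p, q) + t\<^sup>2 * X $$ (q, q)"
proof -
  let ?x = "\<lambda>i. (if i = p then s else 0) + (if i = q then t else 0)"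
  have "card {i. i < n \<and> ?x i \<noteq> 0} \<le> card {p, q}"
    by (intro card_mono) auto
  \<comment> \<open>An inequality, because \<open>p = q\<close> is allowed.\<close>
  also have "\<dots> \<le> 2"
    by (simp add: card_insert_if)
  finally have "0 \<le> quad_form n X ?x"
    using assms(2) by (intro dual_FW_quad_form_nonneg[OF assms(1)]) simp
  then show ?thesis
    using quad_form_two_units[of X n q p s t] assms by (simp add: dual_cone_def)
qed

text \<open>The two forms add up to \<open>(s * a + t * b)^2\<close>, which vanishes at
  \<open>(b, - a)\<close>. Both are nonnegative, so each has a minimum with value zero there, and
  the derivative of the first in \<open>s\<close> must vanish.\<close>

lemma binary_form_summand_of_square:
  fixes a b x y z :: real
  assumes X: "\<And>s t. 0 \<le> s\<^sup>2 * x + 2 * s * t * y + t\<^sup>2 * z"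
    and Y: "\<And>s t. 0 \<le> s\<^sup>2 * (a\<^sup>2 - x) + 2 * s * t * (a * b - y) + t\<^sup>2 * (b\<^sup>2 - z)"
  shows "a * y = b * x"
proof -
  \<comment> \<open>At \<open>(b, - a)\<close> the second form is the negative of the first.\<close>
  have "b\<^sup>2 * x - 2 * a * b * y + a\<^sup>2 * z = 0"
    using X[of b "- a"] Y[of b "- a"] by (simp add: algebra_simps power2_eq_square)
  \<comment> \<open>Moving away from the zero in the first coordinate makes
    \<open>b * x - a * y\<close> the linear coefficient.\<close>
  moreover have "(b + t)\<^sup>2 * x + 2 * (b + t) * (- a) * y + (- a)\<^sup>2 * z
    = (b\<^sup>2 * x - 2 * a * b * y + a\<^sup>2 * z) + (2 * t * (b * x - a * y) + t\<^sup>2 * x)" for t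
    by (simp add: algebra_simps power2_eq_square)
  ultimately have "0 \<le> 2 * t * (b * x - a * y) + t\<^sup>2 * x" for t
    using X[of "b + t" "- a"] by simp
  then have "b * x - a * y = 0"
    by (rule linear_coeff_eq_zero_if_quadratic_nonneg)
  then show ?thesis by simp
qed

text \<open>The relation \<open>cross\<close> for pairs of distinct indices spreads the factor from
  the pivot entry \<open>(p, p)\<close> to row \<open>p\<close>, then to the diagonal, then to all
  entries. The vector \<open>a\<close> may have zeros elsewhere, hence the case distinction at the
  end.\<close>

lemma dual_FW_summand_of_outer_square:
  assumes k: "0 < k" "n = 1 \<or> 2 \<le> k"
    and X: "X \<in> dual_cone n (FW k n)" and Y: "Y \<in> dual_cone n (FW k n)"
    and sum: "outer_square n a = X + Y"
    and p: "p < n" "a p \<noteq> 0"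
  shows "\<exists>c\<ge>0. X = c \<cdot>\<^sub>m outer_square n a"
proof (intro exI conjI)
  \<comment> \<open>The only possible factor, read off at the entry \<open>(p, p)\<close>.\<close>
  let ?c = "X $$ (p, p) / (a p)\<^sup>2"
  show "0 \<le> ?c"
    using dual_FW_diag_nonneg[OF X k(1) p(1)] by simp
  have XC: "X \<in> carrier_mat n n" and YC: "Y \<in> carrier_mat n n"
    and sym: "\<And>i j. i < n \<Longrightarrow> j < n \<Longrightarrow> X $$ (i, j) = X $$ (j, i)"
    using X Y by (auto simp: dual_cone_def sym_mats_iff)
  have Yentry: "Y $$ (i, j) = a i * a j - X $$ (i, j)" if "i < n" "j < n" for i j
    using arg_cong[OF sum, of "\<lambda>M. M $$ (i, j)"] that XC YC by simp
  have cross: "a i * X $$ (i, j) = a j * X $$ (i, i)" if "i < n" "j < n" "i \<noteq> j" for i j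
  proof (rule binary_form_summand_of_square[where z = "X $$ (j, j)"])
    \<comment> \<open>Distinct indices below \<open>n\<close> exclude \<open>n = 1\<close>.\<close>
    have "2 \<le> k" using k that by auto
    note plane = dual_FW_plane_nonneg[OF _ this that(1,2)]
    show "0 \<le> s\<^sup>2 * X $$ (i, i) + 2 * s * t * X $$ (i, j) + t\<^sup>2 * X $$ (j, j)" for s t
      by (rule plane[OF X])
    show "0 \<le> s\<^sup>2 * ((a i)\<^sup>2 - X $$ (i, i)) + 2 * s * t * (a i * a j - X $$ (i, j))
        + t\<^sup>2 * ((a j)\<^sup>2 - X $$ (j, j))" for s t
      using plane[OF Y, of s t] that by (simp add: Yentry power2_eq_square)
  qed
  have row: "X $$ (p, j) = ?c * a p * a j" if "j < n" for j
  proof (cases "j = p")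
    case True
    then show ?thesis using p(2) by (simp add: power2_eq_square)
  next
    case False
    then have "X $$ (p, j) = a j * X $$ (p, p) / a p"
      using cross[OF p(1) that] p(2) by (simp add: eq_divide_eq mult.commute)
    then show ?thesis using p(2) by (simp add: power2_eq_square)
  qed
  have diag: "X $$ (j, j) = ?c * a j * a j" if "j < n" for j
  proof (cases "j = p")
    case True
    then show ?thesis using p(2) by (simp add: power2_eq_square)
  next
    case False
    have "a p * X $$ (j, j) = a j * X $$ (j, p)"
      by (rule cross[OF that p(1) False, symmetric])
    also have "X $$ (j, p) = ?c * a p * a j"
      unfolding sym[OF that p(1)] by (rule row[OF that])
    also have "a j * (?c * a p * a j) = a p * (?c * a j * a j)"
      by simp
    finally show ?thesis
      by (rule mult_left_cancel[OF p(2), THEN iffD1])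
  qed
  have "X $$ (i, j) = ?c * a i * a j" if ij: "i < n" "j < n" for i j
  proof -
    consider "i = j" | "i \<noteq> j" "a i \<noteq> 0" | "i \<noteq> j" "a j \<noteq> 0" | "i \<noteq> j" "a i = 0" "a j = 0"
      by blast
    then show ?thesis
    proof cases
      case 1
      then show ?thesis using diag ij by simp
    next
      case 2
      have "a i * X $$ (i, j) = a j * X $$ (i, i)"
        by (rule cross[OF ij 2(1)])
      also have "\<dots> = a i * (?c * a i * a j)"
        by (simp add: diag[OF ij(1)])
      finally show ?thesis
        by (rule mult_left_cancel[OF 2(2), THEN iffD1])
    next
      case 3
      have "a j * X $$ (i, j) = a i * X $$ (j, j)"
        unfolding sym[OF ij] by (rule cross[OF ij(2,1) 3(1)[symmetric]])
      also have "\<dots> = a j * (?c * a i * a j)"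
        by (simp add: diag[OF ij(2)])
      finally show ?thesis
        by (rule mult_left_cancel[OF 3(2), THEN iffD1])
    next
      \<comment> \<open>Here \<open>cross\<close> says nothing about the entry. Both diagonal
        entries of \<open>X\<close> vanish by \<open>diag\<close>, so nonnegativity on the plane
        leaves a linear term that must be zero.\<close>
      case 4
      then have "2 \<le> k" using k ij by auto
      then have "0 \<le> 2 * t * X $$ (i, j) + t\<^sup>2 * 0" for t
        using dual_FW_plane_nonneg[OF X _ ij, of t 1] diag[OF ij(1)] diag[OF ij(2)] 4 by simp
      then show ?thesis
        using linear_coeff_eq_zero_if_quadratic_nonneg[of "X $$ (i, j)" 0] 4 by simp
    qed
  qed
  then show "X = ?c \<cdot>\<^sub>m outer_square n a"
    using XC by (intro eq_matI) auto
qed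

section \<open>Rank one in terms of entries\<close>

context vec_space
begin

lemma rank_pos_if_nonzero:
  assumes "A \<in> carrier_mat n nc" "A \<noteq> 0\<^sub>m n nc"
  shows "0 < rank A"
proof -
  obtain i j where ij: "i < n" "j < nc" "A $$ (i, j) \<noteq> 0"
    using assms by (auto simp: mat_eq_iff)
  have carr: "{col A j} \<subseteq> carrier_vec n"
    using assms(1) by auto
  have "lin_indpt {col A j}"
  proof
    assume "lin_dep {col A j}"
    then obtain f where f: "lincomb f {col A j} = 0\<^sub>v n" "f (col A j) \<noteq> 0"
      using finite_lin_dep[of "{col A j}"] carr by auto
    then have "f (col A j) * A $$ (i, j) = 0"
      using lincomb_index[OF ij(1) carr, of f] assms(1) ij by simp
    with f(2) ij(3) show False by simp
  qed
  moreover have "{col A j} \<subseteq> set (cols A)"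
    using ij assms(1) by (auto simp: cols_def)
  ultimately show ?thesis
    using rank_ge_card_indpt[OF assms(1), of "{col A j}"] by simp
qed

text \<open>Two distinct columns are linearly dependent, and a nontrivial relation between them
  annihilates every minor they contain.\<close>

lemma two_minor_eq_zero_if_rank_le_1:
  assumes A: "A \<in> carrier_mat n nc" "rank A \<le> 1"
    and idx: "i < n" "j < n" "p < nc" "q < nc"
  shows "A $$ (i, p) * A $$ (j, q) = A $$ (i, q) * A $$ (j, p)"
\<comment> \<open>Equal columns would collapse \<open>?U\<close> to one element, and the rank bound
  would then give no dependence.\<close>
proof (cases "col A p = col A q")
  case True
  then show ?thesis
    using A idx by (metis carrier_matD index_col mult.commute)
next
  case False
  let ?U = "{col A p, col A q}"
  have sub: "?U \<subseteq> set (cols A)"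
    using A idx by (auto simp: cols_def)
  have carr: "?U \<subseteq> carrier_vec n"
    using A by auto
  have "lin_dep ?U"
    using rank_ge_card_indpt[OF A(1) sub] A(2) False by auto
  then obtain f w where f: "lincomb f ?U = 0\<^sub>v n" "w \<in> ?U" "f w \<noteq> 0"
    using finite_lin_dep[of ?U] carr by auto
  have "f (col A p) * A $$ (l, p) + f (col A q) * A $$ (l, q) = 0" if "l < n" for l
    using lincomb_index[OF that carr, of f] f(1) False A idx that by simp
  note rel = this[OF idx(1)] this[OF idx(2)]
  from f(2,3) consider "f (col A p) \<noteq> 0" | "f (col A q) \<noteq> 0" by auto
  then show ?thesis
  proof cases
    case 1
    \<comment> \<open>Eliminating the coefficient of column \<open>q\<close> from the two relations
      in \<open>rel\<close>, as in Cramer's rule.\<close>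
    have "f (col A p) * (A $$ (i, p) * A $$ (j, q) - A $$ (i, q) * A $$ (j, p))
      = A $$ (j, q) * (f (col A p) * A $$ (i, p) + f (col A q) * A $$ (i, q))
        - A $$ (i, q) * (f (col A p) * A $$ (j, p) + f (col A q) * A $$ (j, q))"
      by (simp add: algebra_simps)
    then have "f (col A p) * (A $$ (i, p) * A $$ (j, q) - A $$ (i, q) * A $$ (j, p)) = 0"
      by (simp add: rel)
    with 1 show ?thesis by simp
  next
    case 2
    have "f (col A q) * (A $$ (i, p) * A $$ (j, q) - A $$ (i, q) * A $$ (j, p))
      = A $$ (i, p) * (f (col A p) * A $$ (j, p) + f (col A q) * A $$ (j, q))
        - A $$ (j, p) * (f (col A p) * A $$ (i, p) + f (col A q) * A $$ (i, q))"
      by (simp add: algebra_simps)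
    then have "f (col A q) * (A $$ (i, p) * A $$ (j, q) - A $$ (i, q) * A $$ (j, p)) = 0"
      by (simp add: rel)
    with 2 show ?thesis by simp
  qed
qed

end

lemma psd_rank_1_imp_outer_square:
  assumes A: "A \<in> psd_mats n" and rank: "vec_space.rank n A = 1"
  obtains a p where "p < n" "a p \<noteq> 0" "A = outer_square n a"
proof -
  have AC: "A \<in> carrier_mat n n"
    and sym: "\<And>i j. i < n \<Longrightarrow> j < n \<Longrightarrow> A $$ (i, j) = A $$ (j, i)"
    using A by (auto simp: psd_mats_iff sym_mats_iff)
  have "A \<noteq> 0\<^sub>m n n"
    using rank vec_space.rank_0I[where nc = n and n = n, where ?'a = real] by auto
  then obtain p where p: "p < n" "A $$ (p, p) \<noteq> 0"
    using psd_mats_eq_zero_if_diag_zero[OF A] by blast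
  then have pos: "0 < A $$ (p, p)"
    using psd_mats_diag_nonneg[OF A p(1)] by simp
  \<comment> \<open>Column \<open>p\<close> scaled so that \<open>a i * a j\<close> has denominator
    \<open>A $$ (p, p)\<close>, as the vanishing minor with rows \<open>i\<close>, \<open>p\<close>
    and columns \<open>j\<close>, \<open>p\<close> demands.\<close>
  define a where "a i = A $$ (i, p) / sqrt (A $$ (p, p))" for i
  have "A $$ (i, j) = a i * a j" if ij: "i < n" "j < n" for i j
  proof -
    have "A $$ (i, j) * A $$ (p, p) = A $$ (i, p) * A $$ (p, j)"
      using rank
      by (intro vec_space.two_minor_eq_zero_if_rank_le_1[OF AC _ ij(1) p(1) ij(2) p(1)]) simp
    also have "A $$ (p, j) = A $$ (j, p)"
      by (rule sym[OF p(1) ij(2)])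
    finally have "A $$ (i, j) = A $$ (i, p) * A $$ (j, p) / A $$ (p, p)"
      using pos by (simp add: eq_divide_eq)
    also have "\<dots> = a i * a j"
      using pos by (simp add: a_def)
    finally show ?thesis .
  qed
  then have "A = outer_square n a"
    using AC by (intro eq_matI) auto
  moreover have "a p \<noteq> 0"
    using pos by (simp add: a_def)
  ultimately show thesis
    using that p(1) by blast
qed

section \<open>Extreme rays and rank one\<close>

lemma psd_extreme_imp_rank_1:
  assumes A: "A \<in> psd_mats n" and ext: "spans_extreme_ray (dual_cone n (FW k n)) A"
  shows "vec_space.rank n A = 1"
proof -
  have AC: "A \<in> carrier_mat n n"
    using A by (simp add: psd_mats_iff sym_mats_iff)
  have nz: "A \<noteq> 0\<^sub>m n n"
    using ext AC by (simp add: spans_extreme_ray_def)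
  then obtain p where p: "p < n" "A $$ (p, p) \<noteq> 0"
    using psd_mats_eq_zero_if_diag_zero[OF A] by blast
  then have pos: "0 < A $$ (p, p)"
    using psd_mats_diag_nonneg[OF A p(1)] by simp
  let ?u = "\<lambda>i. A $$ (i, p)"
  let ?X = "(1 / A $$ (p, p)) \<cdot>\<^sub>m outer_square n ?u"
  obtain B where B: "B \<in> psd_mats n" and split: "A = ?X + B"
    using psd_mats_split[OF A p(1) pos] .
  have "?X \<in> psd_mats n"
    using pos by (intro smult_psd outer_square_psd) simp
  then obtain c where c: "?X = c \<cdot>\<^sub>m A"
    using ext B split psd_subset_dual_FW unfolding spans_extreme_ray_def by blast
  have entry: "?u i * ?u j / A $$ (p, p) = c * A $$ (i, j)" if "i < n" "j < n" for i j
    using arg_cong[OF c, of "\<lambda>M. M $$ (i, j)"] that AC by simp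
  \<comment> \<open>The rank one summand agrees with \<open>A\<close> at the pivot entry.\<close>
  have "c = 1"
    using entry[OF p(1) p(1)] pos by simp
  have "A $$ (i, j) = ?u i * (?u j / A $$ (p, p))" if "i < dim_row A" "j < dim_col A" for i j
    using entry[of i j] that AC unfolding \<open>c = 1\<close> by simp
  then have "vec_space.rank n A \<le> 1"
    by (rule vec_space.rank_le_1_product_entries[OF AC])
  then show ?thesis
    using vec_space.rank_pos_if_nonzero[OF AC nz] by simp
qed

text \<open>The case \<open>k = 1\<close>, \<open>2 \<le> n\<close> is excluded: there the dual cone
  is the set of symmetric matrices with nonnegative diagonal, which contains lines and so has no
  extreme rays.\<close>

theorem lemma4p2:
  fixes n k :: nat and A :: "real mat"
  assumes "0 < n" and "0 < k"
    and "n = 1 \<or> 2 \<le> k"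
    and "A \<in> psd_mats n"
  shows "spans_extreme_ray (dual_cone n (FW k n)) A \<longleftrightarrow> vec_space.rank n A = 1"
proof
  assume "spans_extreme_ray (dual_cone n (FW k n)) A"
  then show "vec_space.rank n A = 1"
    using psd_extreme_imp_rank_1 assms(4) by blast
next
  assume "vec_space.rank n A = 1"
  then obtain a p where p: "p < n" "a p \<noteq> 0" and A: "A = outer_square n a"
    using psd_rank_1_imp_outer_square[OF assms(4)] by blast
  have "A $$ (p, p) \<noteq> 0"
    using p A by simp
  then have "A \<noteq> 0\<^sub>m n n"
    using p(1) by auto
  moreover have "A \<in> dual_cone n (FW k n)"
    using assms(4) psd_subset_dual_FW by blast
  moreover have "(\<exists>c\<ge>0. X = c \<cdot>\<^sub>m A) \<and> (\<exists>c\<ge>0. Y = c \<cdot>\<^sub>m A)"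
    if XY: "X \<in> dual_cone n (FW k n)" "Y \<in> dual_cone n (FW k n)" "A = X + Y" for X Y
  proof -
    have "X \<in> carrier_mat n n" "Y \<in> carrier_mat n n"
      using XY by (auto simp: dual_cone_def sym_mats_iff)
    \<comment> \<open>\<open>summand\<close> describes only the first summand; exchanging the two
      covers \<open>Y\<close>.\<close>
    then have comm: "X + Y = Y + X"
      by (rule comm_add_mat)
    have eq: "outer_square n a = X + Y"
      using XY(3) A by simp
    note summand = dual_FW_summand_of_outer_square[where a = a and p = p, OF assms(2,3) _ _ _ p]
    show ?thesis
      unfolding A using summand[OF XY(1,2) eq] summand[OF XY(2,1) eq[unfolded comm]] by blast
  qed
  moreover have "dim_row A = n" "dim_col A = n"
    using A by simp_all
  ultimately show "spans_extreme_ray (dual_cone n (FW k n)) A"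
    unfolding spans_extreme_ray_def by simp
qed

end
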